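(* Let $(A,\cdot_A,[-,-]_A)$ be an $F$-manifold algebra and $T:V\to A$ an $\mathcal{O}$-operator on $A$ with respect to a representation $(V;\rho,\mu)$ of $A$. Define operations $\diamond$ and $\ast$ on $V$ by $$u\diamond v=\mu(T(u))v,\qquad u\ast v=\rho(T(u))v,\qquad u,v\in V.$$ Then $(V,\diamond,\ast)$ is a pre-$F$-manifold algebra and $T$ is a homomorphism of $F$-manifold algebras from the sub-adjacent $F$-manifold algebra $V^c$ to $(A,\cdot_A,[-,-]_A)$.
   Context: All vector spaces are finite dimensional over an algebraically closed field $\mathbb{K}$ of characteristic $0$. An $F$-manifold algebra is a triple $(A,\cdot_A,[-,-]_A)$ where $(A,\cdot_A)$ is a commutative associative algebra and $(A,[-,-]_A)$ is a Lie algebra such that $P_{x\cdot_A y}(z,w)=x\cdot_A P_y(z,w)+y\cdot_A P_x(z,w)$ for all $x,y,z,w\in A$, where $P_x(y,z)=[x,y\cdot_A z]_A-[x,y]_A\cdot_A z-y\cdot_A[x,z]_A$. A homomorphism of $F$-manifold algebras is a linear map preserving both the product and the bracket. A representation of an $F$-manifold algebra $(A,\cdot_A,[-,-]_A)$ is a triple $(V;\rho,\mu)$ with $V$ a vector space and $\rho,\mu:A\to\mathfrak{gl}(V)$ linear, such that $(V;\rho)$ is a representation of the Lie algebra $(A,[-,-]_A)$, $(V;\mu)$ is a representation of the commutative associative algebra $(A,\cdot_A)$ (i.e. $\mu(x\cdot_A y)=\mu(x)\circ\mu(y)$), and for all $x,y,z\in A$ $$R_{\rho,\mu}(x\cdot_A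 y,z)=\mu(x)\circ R_{\rho,\mu}(y,z)+\mu(y)\circ R_{\rho,\mu}(x,z),$$ $$\mu(P_x(y,z))=S_{\rho,\mu}(y,z)\circ\mu(x)-\mu(x)\circ S_{\rho,\mu}(y,z),$$ where $R_{\rho,\mu}(x,y)=\rho(x)\circ\mu(y)-\mu(y)\circ\rho(x)-\mu([x,y]_A)$ and $S_{\rho,\mu}(x,y)=\mu(x)\circ\rho(y)+\mu(y)\circ\rho(x)-\rho(x\cdot_A y)$. An $\mathcal{O}$-operator on $A$ with respect to $(V;\rho,\mu)$ is a linear map $T:V\to A$ such that for all $u,v\in V$: $T(u)\cdot_A T(v)=T(\mu(T(u))v+\mu(T(v))u)$ and $[T(u),T(v)]_A=T(\rho(T(u))v-\rho(T(v))u)$. A Zinbiel algebra is a vector space with a bilinear product $\diamond$ such that $x\diamond(y\diamond z)=(y\diamond x)\diamond z+(x\diamond y)\diamond z$. A pre-Lie algebra is a vector space with a bilinear product $\ast$ such that $(x\ast y)\ast z-x\ast(y\ast z)=(y\ast x)\ast z-y\ast(x\ast z)$. A pre-$F$-manifold algebra is a triple $(B,\diamond,\ast)$ with $(B,\diamond)$ a Zinbiel algebra and $(B,\ast)$ a pre-Lie algebra such that, for all $x,y,z,w\in B$, $$F_1(x\cdot y,z,w)=x\diamond F_1(y,z,w)+y\diamond F_1(x,z,w),$$ $$(F_1(x,y,z)+F_1(x,z,y)+F_2(y,z,x))\diamond w=F_2(y,z,x\diamond w)-x\diamond F_2(y,z,w),$$ where $x\cdot y=x\diamond y+y\diamond x$,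 $[x,y]=x\ast y-y\ast x$, $F_1(x,y,z)=x\ast(y\diamond z)-y\diamond(x\ast z)-[x,y]\diamond z$ and $F_2(x,y,z)=x\diamond(y\ast z)+y\diamond(x\ast z)-(x\cdot y)\ast z$. Its sub-adjacent $F$-manifold algebra is $B^c=(B,\cdot,[-,-])$ with these $\cdot$ and $[-,-]$. *)

theory Defs
  imports Complex_Main "HOL-Computational_Algebra.Polynomial"
begin

text \<open>
  A vector space is a whole type together with a scalar multiplication, as in
  \<^theory>\<open>HOL.Vector_Spaces\<close>. The ground field is algebraically closed of characteristic 0
  and all spaces are finite dimensional.
\<close>

locale fd_vector_space =
  fixes scale :: "'k::{alg_closed_field, field_char_0} \<Rightarrow> 'a::ab_group_add \<Rightarrow> 'a"
  assumes finite_dimensional: "\<exists>Basis. finite_dimensional_vector_space scale Basis"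

text \<open>
  With \<open>s1 = sA\<close> and \<open>s2 = s3 = sV\<close> this also says that \<open>f\<close> is a linear map from \<open>A\<close> to
  \<open>gl(V)\<close>: the second condition puts each \<open>f x\<close> into \<open>gl(V)\<close>, the first is linearity in \<open>x\<close>,
  read pointwise.
\<close>

locale bilinear_map =
  fixes s1 :: "'k::field \<Rightarrow> 'a::ab_group_add \<Rightarrow> 'a"
    and s2 :: "'k \<Rightarrow> 'b::ab_group_add \<Rightarrow> 'b"
    and s3 :: "'k \<Rightarrow> 'c::ab_group_add \<Rightarrow> 'c"
    and f :: "'a \<Rightarrow> 'b \<Rightarrow> 'c"
  assumes linear_left: "Vector_Spaces.linear s1 s3 (\<lambda>x. f x y)"
    and linear_right: "Vector_Spaces.linear s2 s3 (\<lambda>y. f x y)"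

locale bilinear_algebra = fd_vector_space scale + bilinear_map scale scale scale prd
  for scale :: "'k::{alg_closed_field, field_char_0} \<Rightarrow> 'a::ab_group_add \<Rightarrow> 'a"
    and prd :: "'a \<Rightarrow> 'a \<Rightarrow> 'a"

text \<open>Commutative associative algebras are not required to be unital.\<close>

locale comm_assoc_algebra = bilinear_algebra scale prd
  for scale :: "'k::{alg_closed_field, field_char_0} \<Rightarrow> 'a::ab_group_add \<Rightarrow> 'a"
    and prd :: "'a \<Rightarrow> 'a \<Rightarrow> 'a" (infixl \<open>\<bullet>\<close> 70) +
  assumes commute: "x \<bullet> y = y \<bullet> x"
    and assoc: "(x \<bullet> y) \<bullet> z = x \<bullet> (y \<bullet> z)"

locale lie_algebra = bilinear_algebra scale br
  for scale :: "'k::{alg_closed_field, field_char_0} \<Rightarrow> 'a::ab_group_add \<Rightarrow> 'a"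
    and br :: "'a \<Rightarrow> 'a \<Rightarrow> 'a" +
  assumes alternating: "br x x = 0"
    and jacobi: "br x (br y z) + br y (br z x) + br z (br x y) = 0"

definition leibnizator ::
  "('a::ab_group_add \<Rightarrow> 'a \<Rightarrow> 'a) \<Rightarrow> ('a \<Rightarrow> 'a \<Rightarrow> 'a) \<Rightarrow> 'a \<Rightarrow> 'a \<Rightarrow> 'a \<Rightarrow> 'a"
  where "leibnizator prd br x y z = br x (prd y z) - prd (br x y) z - prd y (br x z)"

locale F_manifold_algebra = comm_assoc_algebra scale prd + lie_algebra scale br
  for scale :: "'k::{alg_closed_field, field_char_0} \<Rightarrow> 'a::ab_group_add \<Rightarrow> 'a"
    and prd :: "'a \<Rightarrow> 'a \<Rightarrow> 'a" (infixl \<open>\<bullet>\<close> 70)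
    and br :: "'a \<Rightarrow> 'a \<Rightarrow> 'a" +
  assumes hertling_manin:
    "leibnizator prd br (x \<bullet> y) z w =
       x \<bullet> leibnizator prd br y z w + y \<bullet> leibnizator prd br x z w"

locale F_manifold_hom =
  dom: F_manifold_algebra s1 prd1 br1 +
  cod: F_manifold_algebra s2 prd2 br2 +
  Vector_Spaces.linear s1 s2 f
  for s1 :: "'k::{alg_closed_field, field_char_0} \<Rightarrow> 'a::ab_group_add \<Rightarrow> 'a"
    and prd1 br1 :: "'a \<Rightarrow> 'a \<Rightarrow> 'a"
    and s2 :: "'k \<Rightarrow> 'b::ab_group_add \<Rightarrow> 'b"
    and prd2 br2 :: "'b \<Rightarrow> 'b \<Rightarrow> 'b"
    and f :: "'a \<Rightarrow> 'b" +
  assumes hom_prd: "f (prd1 x y) = prd2 (f x) (f y)"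
    and hom_br: "f (br1 x y) = br2 (f x) (f y)"

definition rep_R ::
  "('a \<Rightarrow> 'a \<Rightarrow> 'a) \<Rightarrow> ('a \<Rightarrow> 'v \<Rightarrow> 'v) \<Rightarrow> ('a \<Rightarrow> 'v \<Rightarrow> 'v) \<Rightarrow> 'a \<Rightarrow> 'a \<Rightarrow> 'v \<Rightarrow> 'v::ab_group_add"
  where "rep_R br \<rho> \<mu> x y v = \<rho> x (\<mu> y v) - \<mu> y (\<rho> x v) - \<mu> (br x y) v"

definition rep_S ::
  "('a \<Rightarrow> 'a \<Rightarrow> 'a) \<Rightarrow> ('a \<Rightarrow> 'v \<Rightarrow> 'v) \<Rightarrow> ('a \<Rightarrow> 'v \<Rightarrow> 'v) \<Rightarrow> 'a \<Rightarrow> 'a \<Rightarrow> 'v \<Rightarrow> 'v::ab_group_add"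
  where "rep_S prd \<rho> \<mu> x y v = \<mu> x (\<rho> y v) + \<mu> y (\<rho> x v) - \<rho> (prd x y) v"

locale F_manifold_representation =
  F_manifold_algebra sA prd br +
  V: fd_vector_space sV +
  rho: bilinear_map sA sV sV \<rho> +
  mu: bilinear_map sA sV sV \<mu>
  for sA :: "'k::{alg_closed_field, field_char_0} \<Rightarrow> 'a::ab_group_add \<Rightarrow> 'a"
    and prd br :: "'a \<Rightarrow> 'a \<Rightarrow> 'a"
    and sV :: "'k \<Rightarrow> 'v::ab_group_add \<Rightarrow> 'v"
    and \<rho> \<mu> :: "'a \<Rightarrow> 'v \<Rightarrow> 'v" +
  assumes rho_br: "\<rho> (br x y) v = \<rho> x (\<rho> y v) - \<rho> y (\<rho> x v)"
    and mu_prd: "\<mu> (prd x y) = \<mu> x \<circ> \<mu> y"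
    and rep_R_prd:
      "rep_R br \<rho> \<mu> (prd x y) z v = \<mu> x (rep_R br \<rho> \<mu> y z v) + \<mu> y (rep_R br \<rho> \<mu> x z v)"
    and mu_leibnizator:
      "\<mu> (leibnizator prd br x y z) v = rep_S prd \<rho> \<mu> y z (\<mu> x v) - \<mu> x (rep_S prd \<rho> \<mu> y z v)"

locale O_operator =
  F_manifold_representation sA prd br sV \<rho> \<mu> +
  T: Vector_Spaces.linear sV sA T
  for sA :: "'k::{alg_closed_field, field_char_0} \<Rightarrow> 'a::ab_group_add \<Rightarrow> 'a"
    and prd br :: "'a \<Rightarrow> 'a \<Rightarrow> 'a"
    and sV :: "'k \<Rightarrow> 'v::ab_group_add \<Rightarrow> 'v"
    and \<rho> \<mu> :: "'a \<Rightarrow> 'v \<Rightarrow> 'v"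
    and T :: "'v \<Rightarrow> 'a" +
  assumes O_prd: "prd (T u) (T v) = T (\<mu> (T u) v + \<mu> (T v) u)"
    and O_br: "br (T u) (T v) = T (\<rho> (T u) v - \<rho> (T v) u)"

locale zinbiel_algebra = bilinear_algebra scale dia
  for scale :: "'k::{alg_closed_field, field_char_0} \<Rightarrow> 'a::ab_group_add \<Rightarrow> 'a"
    and dia :: "'a \<Rightarrow> 'a \<Rightarrow> 'a" (infixl \<open>\<diamondop>\<close> 70) +
  assumes zinbiel: "x \<diamondop> (y \<diamondop> z) = (y \<diamondop> x) \<diamondop> z + (x \<diamondop> y) \<diamondop> z"

locale pre_lie_algebra = bilinear_algebra scale ast
  for scale :: "'k::{alg_closed_field, field_char_0} \<Rightarrow> 'a::ab_group_add \<Rightarrow> 'a"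
    and ast :: "'a \<Rightarrow> 'a \<Rightarrow> 'a" (infixl \<open>\<star>\<close> 70) +
  assumes pre_lie: "(x \<star> y) \<star> z - x \<star> (y \<star> z) = (y \<star> x) \<star> z - y \<star> (x \<star> z)"

definition subadj_prd :: "('a::ab_group_add \<Rightarrow> 'a \<Rightarrow> 'a) \<Rightarrow> 'a \<Rightarrow> 'a \<Rightarrow> 'a"
  where "subadj_prd dia x y = dia x y + dia y x"

definition subadj_br :: "('a::ab_group_add \<Rightarrow> 'a \<Rightarrow> 'a) \<Rightarrow> 'a \<Rightarrow> 'a \<Rightarrow> 'a"
  where "subadj_br ast x y = ast x y - ast y x"

definition pre_F1 ::
  "('a::ab_group_add \<Rightarrow> 'a \<Rightarrow> 'a) \<Rightarrow> ('a \<Rightarrow> 'a \<Rightarrow> 'a) \<Rightarrow> 'a \<Rightarrow> 'a \<Rightarrow> 'a \<Rightarrow> 'a"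
  where "pre_F1 dia ast x y z = ast x (dia y z) - dia y (ast x z) - dia (subadj_br ast x y) z"

definition pre_F2 ::
  "('a::ab_group_add \<Rightarrow> 'a \<Rightarrow> 'a) \<Rightarrow> ('a \<Rightarrow> 'a \<Rightarrow> 'a) \<Rightarrow> 'a \<Rightarrow> 'a \<Rightarrow> 'a \<Rightarrow> 'a"
  where "pre_F2 dia ast x y z = dia x (ast y z) + dia y (ast x z) - ast (subadj_prd dia x y) z"

locale pre_F_manifold_algebra = zinbiel_algebra scale dia + pre_lie_algebra scale ast
  for scale :: "'k::{alg_closed_field, field_char_0} \<Rightarrow> 'a::ab_group_add \<Rightarrow> 'a"
    and dia :: "'a \<Rightarrow> 'a \<Rightarrow> 'a" (infixl \<open>\<diamondop>\<close> 70)
    and ast :: "'a \<Rightarrow> 'a \<Rightarrow> 'a" (infixl \<open>\<star>\<close> 70) +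
  assumes pre_F1_prd:
      "pre_F1 dia ast (subadj_prd dia x y) z w =
         x \<diamondop> pre_F1 dia ast y z w + y \<diamondop> pre_F1 dia ast x z w"
    and pre_F1_F2:
      "(pre_F1 dia ast x y z + pre_F1 dia ast x z y + pre_F2 dia ast y z x) \<diamondop> w =
         pre_F2 dia ast y z (x \<diamondop> w) - x \<diamondop> pre_F2 dia ast y z w"

end

theory Submission
  imports Defs
begin

text \<open>
  The axioms of a pre-F-manifold algebra on \<open>V\<close> are the representation axioms evaluated along \<open>T\<close>.
  For the sub-adjacent algebra, the Leibnizator is
  \<open>P\<^sub>x(y,z) = F\<^sub>1(x,y,z) + F\<^sub>1(x,z,y) + F\<^sub>2(y,z,x)\<close>, so the second pre-F-manifold axiom reads
  \<open>P\<^sub>x(z,w) \<diamondop> y = F\<^sub>2(z,w,x \<diamondop> y) - x \<diamondop> F\<^sub>2(z,w,y)\<close>. Expanding \<open>P\<close> at \<open>x \<cdot> y\<close> and using this for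
  \<open>F\<^sub>2(z,w,x \<diamondop> y)\<close> and \<open>F\<^sub>2(z,w,y \<diamondop> x)\<close> gives the Hertling-Manin relation.
\<close>

context bilinear_map
begin

lemma add_left: "f (x + x') y = f x y + f x' y"
  and diff_left: "f (x - x') y = f x y - f x' y"
proof -
  interpret l: Vector_Spaces.linear s1 s3 "\<lambda>x. f x y" by (rule linear_left)
  show "f (x + x') y = f x y + f x' y" "f (x - x') y = f x y - f x' y"
    by (rule l.add l.diff)+
qed

lemma add_right: "f x (y + y') = f x y + f x y'"
  and diff_right: "f x (y - y') = f x y - f x y'"
proof -
  interpret r: Vector_Spaces.linear s2 s3 "\<lambda>y. f x y" by (rule linear_right)
  show "f x (y + y') = f x y + f x y'" "f x (y - y') = f x y - f x y'"
    by (rule r.add r.diff)+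
qed

end

context bilinear_algebra
begin

lemma vector_space_pair_scale: "vector_space_pair scale scale"
  using finite_dimensional
  by (auto simp: vector_space_pair_def finite_dimensional_vector_space_def)

lemma bilinear_algebra_subadj_prd: "bilinear_algebra scale (subadj_prd prd)"
  by (intro bilinear_algebra.intro bilinear_map.intro fd_vector_space_axioms)
    (simp_all add: subadj_prd_def linear_left linear_right
      vector_space_pair.linear_compose_add[OF vector_space_pair_scale])

lemma bilinear_algebra_subadj_br: "bilinear_algebra scale (subadj_br prd)"
  by (intro bilinear_algebra.intro bilinear_map.intro fd_vector_space_axioms)
    (simp_all add: subadj_br_def linear_left linear_right
      vector_space_pair.linear_compose_sub[OF vector_space_pair_scale])

end

text \<open>Both sides agree after expansion by biadditivity. The form for arbitrary bilinear maps
  lets it apply on the representation space before its operations are known to form a pre-F-manifold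
  algebra.\<close>

lemma leibnizator_subadj:
  assumes "bilinear_map s s s dia" and "bilinear_map s s s ast"
  shows "leibnizator (subadj_prd dia) (subadj_br ast) x y z =
     pre_F1 dia ast x y z + pre_F1 dia ast x z y + pre_F2 dia ast y z x"
proof -
  interpret d: bilinear_map s s s dia by (rule assms(1))
  interpret a: bilinear_map s s s ast by (rule assms(2))
  show ?thesis
    by (simp add: leibnizator_def pre_F1_def pre_F2_def subadj_prd_def subadj_br_def
        d.add_left d.add_right d.diff_left d.diff_right
        a.add_left a.add_right a.diff_left a.diff_right algebra_simps)
qed

context zinbiel_algebra
begin

text \<open>In \<open>pre_F_manifold_algebra\<close> both products inherit facts under the same
  names; the aliases keep them apart.\<close>

lemmas bilinear_map_dia = bilinear_map_axioms
lemmas dia_add_right = add_right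

text \<open>The right-hand side of the Zinbiel identity is symmetric in \<open>x\<close> and
  \<open>y\<close>.\<close>

lemma dia_left_commute: "x \<diamondop> (y \<diamondop> z) = y \<diamondop> (x \<diamondop> z)"
  using zinbiel[of x y z] zinbiel[of y x z] by (simp add: add.commute)

lemma comm_assoc_algebra_subadj: "comm_assoc_algebra scale (subadj_prd dia)"
proof -
  interpret c: bilinear_algebra scale "subadj_prd dia" by (rule bilinear_algebra_subadj_prd)
  \<comment> \<open>Left multiplications represent the sub-adjacent product, so both bracketings
    reduce to right-nested products.\<close>
  have dia_prd: "subadj_prd dia x y \<diamondop> z = x \<diamondop> (y \<diamondop> z)" for x y z
    by (simp add: subadj_prd_def add_left zinbiel add.commute)
  show ?thesis
  proof
    fix x y z
    show "subadj_prd dia x y = subadj_prd dia y x"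
      by (simp add: subadj_prd_def add.commute)
    have "subadj_prd dia (subadj_prd dia x y) z = x \<diamondop> (y \<diamondop> z) + (z \<diamondop> (x \<diamondop> y) + z \<diamondop> (y \<diamondop> x))"
      by (simp add: subadj_prd_def[of _ "subadj_prd dia x y"] dia_prd)
        (simp add: subadj_prd_def add_right)
    \<comment> \<open>Left commutativity moves \<open>z\<close> inward in the last two
      products.\<close>
    also have "\<dots> = (x \<diamondop> (y \<diamondop> z) + x \<diamondop> (z \<diamondop> y)) + y \<diamondop> (z \<diamondop> x)"
      by (simp add: dia_left_commute[of z] add.assoc)
    also have "\<dots> = subadj_prd dia x (subadj_prd dia y z)"
      by (simp add: subadj_prd_def[of _ x] dia_prd) (simp add: subadj_prd_def add_right)
    finally show "subadj_prd dia (subadj_prd dia x y) z = subadj_prd dia x (subadj_prd dia y z)" .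
  qed
qed

end

context pre_lie_algebra
begin

lemmas bilinear_map_ast = bilinear_map_axioms
lemmas ast_add_right = add_right

text \<open>This is the pre-Lie identity rearranged: left multiplications represent the commutator
  bracket.\<close>

lemma subadj_br_ast: "subadj_br ast x y \<star> z = x \<star> (y \<star> z) - y \<star> (x \<star> z)"
  using pre_lie[of x y z] by (simp add: subadj_br_def diff_left algebra_simps)

lemma lie_algebra_subadj: "lie_algebra scale (subadj_br ast)"
proof -
  interpret c: bilinear_algebra scale "subadj_br ast" by (rule bilinear_algebra_subadj_br)
  \<comment> \<open>With all products right-nested, the twelve terms of the Jacobi sum cancel in
    pairs.\<close>
  have expand: "subadj_br ast x (subadj_br ast y z) =
      x \<star> (y \<star> z) - x \<star> (z \<star> y) - (y \<star> (z \<star> x) - z \<star> (y \<star> x))" for x y z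
    by (simp add: subadj_br_def[of _ x] subadj_br_ast) (simp add: subadj_br_def diff_right)
  show ?thesis
    by unfold_locales (simp add: subadj_br_def, simp only: expand, simp add: algebra_simps)
qed

end

context pre_F_manifold_algebra
begin

lemmas leibnizator_eq = leibnizator_subadj[OF bilinear_map_dia bilinear_map_ast]

lemma pre_F2_dia:
  "pre_F2 dia ast z w (x \<diamondop> y) =
     leibnizator (subadj_prd dia) (subadj_br ast) x z w \<diamondop> y + x \<diamondop> pre_F2 dia ast z w y"
  by (simp add: leibnizator_eq pre_F1_F2)

lemma pre_F2_add:
  "pre_F2 dia ast z w (x + y) = pre_F2 dia ast z w x + pre_F2 dia ast z w y"
  by (simp add: pre_F2_def dia_add_right ast_add_right algebra_simps)

lemma F_manifold_algebra_subadj: "F_manifold_algebra scale (subadj_prd dia) (subadj_br ast)"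
proof -
  interpret p: comm_assoc_algebra scale "subadj_prd dia" by (rule comm_assoc_algebra_subadj)
  interpret b: lie_algebra scale "subadj_br ast" by (rule lie_algebra_subadj)
  show ?thesis
  proof
    fix x y z w
    let ?P = "leibnizator (subadj_prd dia) (subadj_br ast)"
    \<comment> \<open>The first two groups come from the first axiom; the last comes from
      \<open>pre_F2_dia\<close> applied to both summands of the product of \<open>x\<close> and
      \<open>y\<close>.\<close>
    have "?P (subadj_prd dia x y) z w =
        (x \<diamondop> pre_F1 dia ast y z w + y \<diamondop> pre_F1 dia ast x z w)
        + (x \<diamondop> pre_F1 dia ast y w z + y \<diamondop> pre_F1 dia ast x w z)
        + ((?P x z w \<diamondop> y + x \<diamondop> pre_F2 dia ast z w y)
          + (?P y z w \<diamondop> x + y \<diamondop> pre_F2 dia ast z w x))"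
      by (simp add: leibnizator_eq[of "subadj_prd dia x y"] pre_F1_prd)
        (simp add: subadj_prd_def pre_F2_add pre_F2_dia)
    \<comment> \<open>The three terms under left multiplication by \<open>x\<close> reassemble into
      the Leibnizator at \<open>y\<close>, and likewise with \<open>x\<close> and \<open>y\<close>
      exchanged.\<close>
    also have "\<dots> = (x \<diamondop> ?P y z w + ?P y z w \<diamondop> x) + (y \<diamondop> ?P x z w + ?P x z w \<diamondop> y)"
      by (simp add: leibnizator_eq dia_add_right algebra_simps)
    finally show "?P (subadj_prd dia x y) z w =
        subadj_prd dia x (?P y z w) + subadj_prd dia y (?P x z w)"
      by (simp add: subadj_prd_def)
  qed
qed

end

lemma (in bilinear_map) bilinear_map_compose_left:
  assumes "Vector_Spaces.linear s0 s1 g"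
  shows "bilinear_map s0 s2 s3 (\<lambda>x. f (g x))"
proof (rule bilinear_map.intro)
  show "Vector_Spaces.linear s0 s3 (\<lambda>x. f (g x) y)" for y
    using Vector_Spaces.linear_compose[OF assms linear_left[of y]] by (simp add: o_def)
  show "Vector_Spaces.linear s2 s3 (\<lambda>y. f (g x) y)" for x
    by (rule linear_right)
qed

context O_operator
begin

abbreviation dia :: "'v \<Rightarrow> 'v \<Rightarrow> 'v"
  where "dia u v \<equiv> \<mu> (T u) v"

abbreviation ast :: "'v \<Rightarrow> 'v \<Rightarrow> 'v"
  where "ast u v \<equiv> \<rho> (T u) v"

lemma T_subadj_prd: "T (subadj_prd dia u v) = prd (T u) (T v)"
  by (simp add: subadj_prd_def O_prd)

lemma T_subadj_br: "T (subadj_br ast u v) = br (T u) (T v)"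
  by (simp add: subadj_br_def O_br)

text \<open>The definitions match term by term, since \<open>T\<close> carries the sub-adjacent
  bracket to \<open>br\<close>.\<close>

lemma pre_F1_eq_rep_R: "pre_F1 dia ast x y z = rep_R br \<rho> \<mu> (T x) (T y) z"
  by (simp add: pre_F1_def rep_R_def T_subadj_br)

lemma pre_F2_eq_rep_S: "pre_F2 dia ast x y z = rep_S prd \<rho> \<mu> (T x) (T y) z"
  by (simp add: pre_F2_def rep_S_def T_subadj_prd)

lemma bilinear_map_dia: "bilinear_map sV sV sV dia"
  by (rule mu.bilinear_map_compose_left[OF T.linear_axioms])

lemma bilinear_map_ast: "bilinear_map sV sV sV ast"
  by (rule rho.bilinear_map_compose_left[OF T.linear_axioms])

text \<open>The argument of \<open>T\<close> is the Leibnizator of the sub-adjacent operations, and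
  \<open>T\<close> is linear and preserves both operations.\<close>

lemma T_pre_F:
  "T (pre_F1 dia ast x y z + pre_F1 dia ast x z y + pre_F2 dia ast y z x) =
     leibnizator prd br (T x) (T y) (T z)"
  unfolding leibnizator_subadj[OF bilinear_map_dia bilinear_map_ast, symmetric]
  by (simp add: leibnizator_def T_subadj_prd T_subadj_br T.diff)

lemma pre_F_manifold_algebra: "pre_F_manifold_algebra sV dia ast"
proof -
  interpret d: bilinear_map sV sV sV dia by (rule bilinear_map_dia)
  interpret a: bilinear_map sV sV sV ast by (rule bilinear_map_ast)
  show ?thesis
  proof
    fix x y z w
    \<comment> \<open>The Zinbiel identity is multiplicativity of \<open>\<mu>\<close> along
      \<open>T\<close>; the pre-Lie identity below is likewise the Lie representation property of
      \<open>\<rho>\<close>.\<close>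
    have "dia x (dia y z) = dia (subadj_prd dia x y) z"
      by (simp add: T_subadj_prd mu_prd)
    then show "dia x (dia y z) = dia (dia y x) z + dia (dia x y) z"
      by (simp add: subadj_prd_def T.add mu.add_left add.commute)
    have "ast (subadj_br ast x y) z = ast x (ast y z) - ast y (ast x z)"
      by (simp add: T_subadj_br rho_br)
    then show "ast (ast x y) z - ast x (ast y z) = ast (ast y x) z - ast y (ast x z)"
      by (simp add: subadj_br_def T.diff rho.diff_left algebra_simps)
    show "pre_F1 dia ast (subadj_prd dia x y) z w =
        dia x (pre_F1 dia ast y z w) + dia y (pre_F1 dia ast x z w)"
      by (simp add: pre_F1_eq_rep_R T_subadj_prd rep_R_prd)
    show "dia (pre_F1 dia ast x y z + pre_F1 dia ast x z y + pre_F2 dia ast y z x) w =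
        pre_F2 dia ast y z (dia x w) - dia x (pre_F2 dia ast y z w)"
      \<comment> \<open>\<open>T_pre_F\<close> has to act first, while the sum under
        \<open>T\<close> still contains \<open>pre_F2\<close>.\<close>
      by (simp only: T_pre_F mu_leibnizator) (simp only: pre_F2_eq_rep_S)
  qed
qed

lemma F_manifold_hom: "F_manifold_hom sV (subadj_prd dia) (subadj_br ast) sA prd br T"
proof -
  interpret c: F_manifold_algebra sV "subadj_prd dia" "subadj_br ast"
    by (rule pre_F_manifold_algebra.F_manifold_algebra_subadj[OF pre_F_manifold_algebra])
  show ?thesis
    by unfold_locales (rule T_subadj_prd T_subadj_br)+
qed

end

theorem theorem4p19:
  fixes sA :: "'k::{alg_closed_field, field_char_0} \<Rightarrow> 'a::ab_group_add \<Rightarrow> 'a"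
    and prd br :: "'a \<Rightarrow> 'a \<Rightarrow> 'a"
    and sV :: "'k \<Rightarrow> 'v::ab_group_add \<Rightarrow> 'v"
    and \<rho> \<mu> :: "'a \<Rightarrow> 'v \<Rightarrow> 'v"
    and T :: "'v \<Rightarrow> 'a"
    and dia ast :: "'v \<Rightarrow> 'v \<Rightarrow> 'v"
  assumes "F_manifold_algebra sA prd br"
    and "F_manifold_representation sA prd br sV \<rho> \<mu>"
    and "O_operator sA prd br sV \<rho> \<mu> T"
    and "\<And>u v. dia u v = \<mu> (T u) v"
    and "\<And>u v. ast u v = \<rho> (T u) v"
  shows "pre_F_manifold_algebra sV dia ast \<and>
         F_manifold_hom sV (subadj_prd dia) (subadj_br ast) sA prd br T"
proof -
  have "dia = (\<lambda>u. \<mu> (T u))" "ast = (\<lambda>u. \<rho> (T u))"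
    using assms(4,5) by (auto simp: fun_eq_iff)
  then show ?thesis
    using O_operator.pre_F_manifold_algebra[OF assms(3)] O_operator.F_manifold_hom[OF assms(3)]
    by simp
qed

end
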